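(* Let $U_1,\dots,U_n$ be i.i.d. random variables uniformly distributed over $(0,1]$, let $\alpha_1,\dots,\alpha_n>0$, and let $f_{\{\alpha_1,\dots,\alpha_n\}}$ and $F_{\{\alpha_1,\dots,\alpha_n\}}$ denote respectively the probability density and the cumulative distribution function of $U_1^{1/\alpha_1}\cdot U_2^{1/\alpha_2}\cdots U_n^{1/\alpha_n}$. Then: (a) For $0<x_n\le1$, $$f_{\{\alpha_1,\dots,\alpha_n\}}(x_n)=\alpha_n x_n^{\alpha_n-1}\int_{x_n}^1\alpha_{n-1}x_{n-1}^{\alpha_{n-1}-\alpha_n-1}\int_{x_{n-1}}^1\alpha_{n-2}x_{n-2}^{\alpha_{n-2}-\alpha_{n-1}-1}\cdots\int_{x_3}^1\alpha_2x_2^{\alpha_2-\alpha_3-1}\int_{x_2}^1\alpha_1x_1^{\alpha_1-\alpha_2-1}\,dx_1\,dx_2\cdots dx_{n-2}\,dx_{n-1}.$$ (b) If $\alpha_1=\dots=\alpha_m=\alpha$ (with $m\ge 1$ factors), then $$f_{\{\underbrace{\alpha,\dots,\alpha}_{m\text{ times}}\}}(x)=\alpha x^{\alpha-1}\frac{(-\alpha\log x)^{m-1}}{(m-1)!}\quad\text{for }0<x\le1,$$ $$F_{\{\underbrace{\alpha,\dots,\alpha}_{m\text{ times}}\}}(s)=s^{\alpha}\sum_{j=0}^{m-1}\frac{(-\alpha\log s)^j}{j!}\quad\text{for }0<s\le1,$$ and $F_{\{\alpha,\dots,\alpha\}}(s)=1$ for $s\ge1$ and $F_{\{\alpha,\dots,\alpha\}}(s)=0$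 for $s<0$. (c) If $\alpha_1,\dots,\alpha_n$ are distinct and $$C_{j,n}:=\prod_{k=1,\,k\neq j}^n\frac{\alpha_k}{\alpha_k-\alpha_j},\qquad c_{j,n}:=\prod_{k=1,\,k\neq j}^n\frac{1}{\alpha_k-\alpha_j},$$ then $$f_{\{\alpha_1,\dots,\alpha_n\}}(x)=\sum_{j=1}^nC_{j,n}\,\alpha_jx^{\alpha_j-1}=\alpha_1\cdots\alpha_n\sum_{j=1}^nc_{j,n}\,x^{\alpha_j-1},\qquad0<x\le1,$$ and $$F_{\{\alpha_1,\dots,\alpha_n\}}(s)=\sum_{j=1}^nC_{j,n}\,s^{\alpha_j}\quad\text{for }0<s\le1,\qquad\text{where }\sum_{j=1}^nC_{j,n}=1.$$
   Context: Densities are with respect to Lebesgue measure; the formulas for $f$ on $(0,1]$ give a version of the density (which is $0$ outside $(0,1]$). For $n=1$ the formula in (a) is read as $f_{\{\alpha_1\}}(x_1)=\alpha_1x_1^{\alpha_1-1}$. Empty products equal $1$ and $0^0=1$. *)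

theory Defs
  imports "HOL-Probability.Probability"
begin

definition power_prod :: "(nat \<Rightarrow> 'a \<Rightarrow> real) \<Rightarrow> (nat \<Rightarrow> real) \<Rightarrow> nat \<Rightarrow> 'a \<Rightarrow> real" where
  "power_prod U \<alpha> n = (\<lambda>\<omega>. \<Prod>i=1..n. U i \<omega> powr (1 / \<alpha> i))"

text \<open>Densities are real-valued; nonnegativity is required explicitly because \<open>ennreal\<close>
  would otherwise silently truncate negative values to \<open>0\<close>.\<close>

definition has_pdf :: "'a measure \<Rightarrow> ('a \<Rightarrow> real) \<Rightarrow> (real \<Rightarrow> real) \<Rightarrow> bool" where
  "has_pdf M X f \<longleftrightarrow> (\<forall>x. 0 \<le> f x) \<and> distributed M lborel X (\<lambda>x. ennreal (f x))"

text \<open>\<open>iter_integral \<alpha> k x\<close> is the \<open>k\<close>-fold nested integral over \<open>x\<^sub>k, \<dots>, x\<^sub>1\<close>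
  (outermost to innermost), with \<open>x\<close> in the role of \<open>x\<^bsub>k+1\<^esub>\<close>, the lower limit of the
  outermost integral.\<close>

fun iter_integral :: "(nat \<Rightarrow> real) \<Rightarrow> nat \<Rightarrow> real \<Rightarrow> real" where
  "iter_integral \<alpha> 0 x = 1"
| "iter_integral \<alpha> (Suc k) x =
     (LBINT y:{x..1}. \<alpha> (k + 1) * y powr (\<alpha> (k + 1) - \<alpha> (k + 2) - 1) * iter_integral \<alpha> k y)"

definition C_coeff :: "(nat \<Rightarrow> real) \<Rightarrow> nat \<Rightarrow> nat \<Rightarrow> real" where
  "C_coeff \<alpha> n j = (\<Prod>k\<in>{1..n} - {j}. \<alpha> k / (\<alpha> k - \<alpha> j))"

definition c_coeff :: "(nat \<Rightarrow> real) \<Rightarrow> nat \<Rightarrow> nat \<Rightarrow> real" where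
  "c_coeff \<alpha> n j = (\<Prod>k\<in>{1..n} - {j}. 1 / (\<alpha> k - \<alpha> j))"

end

theory Submission
  imports Defs
begin

text \<open>Write \<open>V\<^sub>i = U\<^sub>i powr (1 / \<alpha>\<^sub>i)\<close>. The distribution function of \<open>V\<^sub>i\<close> on \<open>(0,1]\<close> is
  \<open>s powr \<alpha>\<^sub>i\<close>, so \<open>V\<^sub>i\<close> has density \<open>\<alpha>\<^sub>i * v powr (\<alpha>\<^sub>i - 1)\<close> there. If a positive random variable
  has density \<open>g\<close> and an independent one has density \<open>h\<close>, the product has the multiplicative
  convolution \<open>z \<mapsto> \<integral> g x * h (z / x) / x dx\<close> as its density. For \<open>h v = b * v powr (b - 1)\<close> on \<open>(0,1]\<close>
  the factor \<open>z powr (b - 1)\<close> comes out of the integral and leaves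
  \<open>b * z powr (b - 1) * \<integral>\<^bsub>z\<^esub>\<^sup>1 x powr (- b) * g x dx\<close>; with
  \<open>g x = \<alpha>\<^sub>n * x powr (\<alpha>\<^sub>n - 1) * iter_integral \<alpha> (n - 1) x\<close> and \<open>b = \<alpha>\<^bsub>n+1\<^esub>\<close> that integral is the next
  iterated integral, by definition. This is the induction step behind formula (a)
  (\<open>nested_density_convolution\<close>, \<open>has_pdf_power_prod\<close>).
  
  The closed forms in (b) and (c) are evaluations of the iterated integral by the fundamental theorem
  of calculus, one variable at a time (\<open>iter_integral_const\<close>, \<open>iter_integral_distinct\<close>). For distinct
  exponents each integration contributes a boundary term at \<open>1\<close>, whose coefficient has to be
  recognised as the new partial-fraction coefficient; this is the identity \<open>\<Sum>\<^sub>j C\<^sub>j * \<alpha>\<^sub>j = 0\<close>, which, like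
  \<open>\<Sum>\<^sub>j C\<^sub>j = 1\<close>, comes from Lagrange interpolation of the constant polynomial \<open>1\<close>.
  
  The distribution functions follow by exhibiting antiderivatives \<open>G\<close> of the densities with \<open>G 1 = 1\<close>
  and integrating the density over the tail \<open>[s,1]\<close> (\<open>cdf_of_unit_interval_density\<close>).\<close>

section \<open>Lagrange interpolation of the constant polynomial\<close>

text \<open>The Lagrange basis polynomials for the nodes \<open>a j\<close> sum to the interpolation polynomial of the
  constant \<open>1\<close>: the sum has degree below the number of nodes and takes the value \<open>1\<close> at each of them.\<close>

lemma lagrange_basis_sum_eq_1:
  fixes a :: "'i \<Rightarrow> 'b::field"
  assumes "finite A" "A \<noteq> {}" "inj_on a A"
  shows "(\<Sum>j\<in>A. \<Prod>k\<in>A - {j}. (a k - x) / (a k - a j)) = 1"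
proof -
  define L where "L j = (\<Prod>k\<in>A - {j}. [:a k / (a k - a j), - 1 / (a k - a j):])" for j
  have poly_L: "poly (L j) y = (\<Prod>k\<in>A - {j}. (a k - y) / (a k - a j))" for j y
    unfolding L_def poly_prod by (intro prod.cong refl) (simp add: diff_divide_distrib)
  have deg: "degree (L j) \<le> card A - 1" if "j \<in> A" for j
  proof -
    have "degree (L j) \<le> (\<Sum>k\<in>A - {j}. degree [:a k / (a k - a j), - 1 / (a k - a j):])"
      unfolding L_def by (rule order_trans[OF degree_prod_sum_le]) (use assms(1) in \<open>simp_all add: o_def\<close>)
    also have "\<dots> \<le> (\<Sum>k\<in>A - {j}. 1)"
      by (intro sum_mono) simp
    also have "\<dots> = card A - 1"
      using assms(1) that by simp
    finally show ?thesis .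
  qed
  have card: "card (a ` A) = card A" "card A > 0"
    using assms by (auto simp: card_image card_gt_0_iff)
  have "(\<Sum>j\<in>A. L j) = 1"
  proof (rule poly_eqI_degree[where A = "a ` A"])
    fix y assume "y \<in> a ` A"
    then obtain i where i: "i \<in> A" "y = a i" by blast
    have "poly (L j) y = (if j = i then 1 else 0)" if "j \<in> A" for j
    proof (cases "j = i")
      case True
      then show ?thesis
        using i by (auto simp: poly_L inj_on_eq_iff[OF assms(3)] intro!: prod.neutral)
    next
      case False
      then show ?thesis
        using i assms(1) by (auto simp: poly_L intro!: prod_zero bexI[of _ i])
    qed
    then show "poly (\<Sum>j\<in>A. L j) y = poly 1 y"
      using i assms(1) by (simp add: poly_sum)
  next
    have "degree (\<Sum>j\<in>A. L j) \<le> card A - 1"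
      using assms(1) deg by (intro degree_sum_le) auto
    then show "degree (\<Sum>j\<in>A. L j) < card (a ` A)"
      using card by simp
  qed (use card in simp)
  then have "poly (\<Sum>j\<in>A. L j) x = 1" by simp
  then show ?thesis by (simp add: poly_sum poly_L)
qed

text \<open>\<open>C_coeff \<alpha> n j\<close> is the \<open>j\<close>-th Lagrange basis polynomial for the nodes \<open>\<alpha> 1, \<dots>, \<alpha> n\<close>, evaluated at \<open>0\<close>.\<close>

lemma sum_C_coeff:
  assumes "1 \<le> n" "inj_on \<alpha> {1..n}"
  shows "(\<Sum>j=1..n. C_coeff \<alpha> n j) = 1"
  using lagrange_basis_sum_eq_1[of "{1..n}" \<alpha> 0] assms by (simp add: C_coeff_def)

lemma C_coeff_Suc:
  assumes "j \<in> {1..n}"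
  shows "C_coeff \<alpha> (Suc n) j = \<alpha> (Suc n) / (\<alpha> (Suc n) - \<alpha> j) * C_coeff \<alpha> n j"
proof -
  have "{1..Suc n} - {j} = insert (Suc n) ({1..n} - {j})"
    using assms by auto
  then show ?thesis by (simp add: C_coeff_def)
qed

text \<open>With at least two factors the density of the product vanishes at \<open>1\<close>, and this is the algebraic form
  of that fact. It holds because passing from \<open>n\<close> to \<open>n + 1\<close> nodes multiplies the \<open>j\<close>-th coefficient by
  \<open>b / (b - \<alpha> j)\<close>, where \<open>b = \<alpha> (n + 1)\<close>; summing the cross-multiplied relation and using that both
  families of coefficients sum to \<open>1\<close> gives \<open>b - \<Sum>\<^sub>j C\<^sub>j * \<alpha> j = b\<close>.\<close>

lemma sum_C_coeff_mult_eq_0: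
  assumes "1 \<le> n" "inj_on \<alpha> {1..Suc n}"
  shows "(\<Sum>j=1..Suc n. C_coeff \<alpha> (Suc n) j * \<alpha> j) = 0"
proof -
  let ?b = "\<alpha> (Suc n)"
  have inj: "inj_on \<alpha> {1..n}"
    by (rule inj_on_subset[OF assms(2)]) auto
  have neq: "?b \<noteq> \<alpha> j" if "j \<in> {1..n}" for j
    using inj_onD[OF assms(2), of "Suc n" j] that by auto
  have "(\<Sum>j=1..Suc n. C_coeff \<alpha> (Suc n) j * (?b - \<alpha> j))
      = (\<Sum>j=1..n. C_coeff \<alpha> (Suc n) j * (?b - \<alpha> j))"
    \<comment> \<open>The term for the new node \<open>b\<close> vanishes.\<close>
    by simp
  also have "\<dots> = (\<Sum>j=1..n. ?b * C_coeff \<alpha> n j)"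
    by (intro sum.cong refl) (use neq in \<open>simp add: C_coeff_Suc\<close>)
  also have "\<dots> = ?b"
    using sum_C_coeff[OF assms(1) inj] by (simp only: sum_distrib_left[symmetric] mult_1_right)
  finally have "?b * (\<Sum>j=1..Suc n. C_coeff \<alpha> (Suc n) j)
      - (\<Sum>j=1..Suc n. C_coeff \<alpha> (Suc n) j * \<alpha> j) = ?b"
    by (simp add: algebra_simps sum_subtractf sum_distrib_left)
  then show ?thesis
    using sum_C_coeff[of "Suc n" \<alpha>] assms by simp
qed

lemma C_coeff_eq_prod_c_coeff:
  assumes "j \<in> {1..n}"
  shows "C_coeff \<alpha> n j * \<alpha> j = (\<Prod>k=1..n. \<alpha> k) * c_coeff \<alpha> n j"
proof -
  have "(\<Prod>k=1..n. \<alpha> k) = \<alpha> j * (\<Prod>k\<in>{1..n} - {j}. \<alpha> k)"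
    using assms by (intro prod.remove) auto
  then show ?thesis
    by (simp add: C_coeff_def c_coeff_def prod_dividef)
qed

section \<open>The iterated integral\<close>

lemma LBINT_FTC:
  fixes F f :: "real \<Rightarrow> real"
  assumes "a \<le> b"
    and "\<And>y. a \<le> y \<Longrightarrow> y \<le> b \<Longrightarrow> (F has_real_derivative f y) (at y)"
    and "continuous_on {a..b} f"
  shows "(LBINT y:{a..b}. f y) = F b - F a"
proof -
  have "(f has_integral (F b - F a)) {a..b}"
    using assms by (intro fundamental_theorem_of_calculus)
      (auto simp: has_real_derivative_iff_has_vector_derivative[symmetric]
        intro: has_field_derivative_at_within)
  then show ?thesis
    using set_borel_integral_eq_integral(2)[OF borel_integrable_atLeastAtMost'[OF assms(3)]]
    by (simp add: integral_unique)
qed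

text \<open>The integrands may blow up at \<open>0\<close>, so continuity is first obtained on each \<open>[c,1]\<close> with \<open>c > 0\<close>, where
  the integrals are proper. It supplies the integrability needed to pass between the Lebesgue
  integral over \<open>[z,1]\<close> and its nonnegative counterpart in the convolution formula.\<close>

lemma continuous_on_iter_integral: "continuous_on {0<..1} (iter_integral \<alpha> k)"
proof (induction k)
  case (Suc k)
  define g where "g y = \<alpha> (k + 1) * y powr (\<alpha> (k + 1) - \<alpha> (k + 2) - 1) * iter_integral \<alpha> k y" for y
  have g: "continuous_on {0<..1} g"
    unfolding g_def by (intro continuous_intros Suc) auto
  have cont: "continuous_on {c..1} (iter_integral \<alpha> (Suc k))" if "0 < c" for c
  proof -
    have sub: "continuous_on {x..1} g" if "c \<le> x" for x
      by (rule continuous_on_subset[OF g]) (use that \<open>0 < c\<close> in auto)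
    have "continuous_on {c..1} (\<lambda>x. integral {x..1} g)"
      by (intro indefinite_integral_continuous_1' integrable_continuous_interval sub) simp
    moreover have "integral {x..1} g = iter_integral \<alpha> (Suc k) x" if "x \<in> {c..1}" for x
      using set_borel_integral_eq_integral(2)[OF borel_integrable_atLeastAtMost'[OF sub]] that
      by (simp add: g_def)
    ultimately show ?thesis
      by (rule continuous_on_eq)
  qed
  show ?case
    unfolding continuous_on_eq_continuous_within
  proof
    fix x :: real assume x: "x \<in> {0<..1}"
    have "continuous (at x within {x/2..1}) (iter_integral \<alpha> (Suc k))"
      using cont[of "x/2"] x by (simp add: continuous_on_eq_continuous_within del: iter_integral.simps)
    moreover have "at x within {x/2..1} = at x within {0<..1}"
      by (rule at_within_nhd[of _ "{x/2<..}"]) (use x in auto)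
    ultimately show "continuous (at x within {0<..1}) (iter_integral \<alpha> (Suc k))"
      by simp
  qed
qed simp

lemma iter_integral_nonneg:
  assumes "\<And>i. i \<in> {1..k} \<Longrightarrow> 0 < \<alpha> i"
  shows "0 \<le> iter_integral \<alpha> k x"
  using assms
proof (induction k arbitrary: x)
  case (Suc k)
  have "0 \<le> iter_integral \<alpha> k y" for y
    by (rule Suc.IH) (use Suc.prems in auto)
  moreover have "0 < \<alpha> (k + 1)"
    using Suc.prems by simp
  ultimately show ?case
    by (auto simp: set_lebesgue_integral_def intro!: integral_nonneg_AE)
qed simp

lemma has_derivative_power_ln_div_fact:
  assumes "0 < x"
  shows "((\<lambda>y. (- a * ln y) ^ Suc k / fact (Suc k)) has_real_derivative
    (- a * ln x) ^ k / fact k * (- a / x)) (at x)"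
proof -
  have "((\<lambda>y. (- a * ln y) ^ Suc k) has_real_derivative
      real (Suc k) * ((- a * ln x) ^ k * (- a / x))) (at x)"
    using assms by (auto intro!: derivative_eq_intros simp del: power_Suc of_nat_Suc)
  from DERIV_cdivide[OF this, of "fact (Suc k)"] show ?thesis
    by (rule DERIV_cong) (simp del: of_nat_Suc)
qed

text \<open>With equal exponents the kernel reduces to \<open>a / y\<close>, which is minus the derivative of \<open>- a * ln y\<close>;
  each integration therefore raises the divided power \<open>(- a * ln y) ^ k / k!\<close> by one, with no boundary
  term at \<open>1\<close>.\<close>

lemma iter_integral_const:
  assumes "\<And>i. i \<in> {1..Suc k} \<Longrightarrow> \<alpha> i = a" "0 < x" "x \<le> 1"
  shows "iter_integral \<alpha> k x = (- a * ln x) ^ k / fact k"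
  using assms
proof (induction k arbitrary: x)
  case (Suc k)
  let ?F = "\<lambda>y. - ((- a * ln y) ^ Suc k / fact (Suc k))"
  let ?f = "\<lambda>y. a * y powr (- 1) * ((- a * ln y) ^ k / fact k)"
  have "iter_integral \<alpha> (Suc k) x = (LBINT y:{x..1}. ?f y)"
    unfolding iter_integral.simps
    by (rule set_lebesgue_integral_cong) (use Suc in auto)
  also have "\<dots> = ?F 1 - ?F x"
  proof (rule LBINT_FTC)
    fix y assume y: "x \<le> y" "y \<le> 1"
    have "y > 0" using Suc.prems y by simp
    then have "- ((- a * ln y) ^ k / fact k * (- a / y)) = ?f y"
      by (simp add: powr_minus divide_inverse)
    with DERIV_minus[OF has_derivative_power_ln_div_fact[OF \<open>y > 0\<close>]]
    show "(?F has_real_derivative ?f y) (at y)"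
      by metis
  qed (use Suc.prems in \<open>auto intro!: continuous_intros\<close>)
  finally show ?case by simp
qed simp

text \<open>Integrating \<open>y powr (\<alpha> j - b - 1)\<close> from \<open>x\<close> to \<open>1\<close> divides by \<open>b - \<alpha> j\<close>, which together with the
  prefactor \<open>b\<close> turns \<open>C\<^bsub>j,n\<^esub>\<close> into \<open>C\<^bsub>j,n+1\<^esub>\<close>. The lower limit yields the terms \<open>j \<le> n\<close> of the new sum, and the contributions of the
  upper limit \<open>1\<close> all carry the power \<open>x powr (b - 1)\<close> and add up to the term \<open>j = n + 1\<close>, by
  \<open>sum_C_coeff_mult_eq_0\<close>.\<close>

lemma iter_integral_distinct:
  assumes "inj_on \<alpha> {1..Suc k}" "0 < x" "x \<le> 1"
  shows "\<alpha> (Suc k) * x powr (\<alpha> (Suc k) - 1) * iter_integral \<alpha> k x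
    = (\<Sum>j=1..Suc k. C_coeff \<alpha> (Suc k) j * \<alpha> j * x powr (\<alpha> j - 1))"
  using assms
proof (induction k arbitrary: x)
  case 0
  then show ?case by (simp add: C_coeff_def)
next
  case (Suc k)
  let ?n = "Suc k"
  define b where "b = \<alpha> (Suc ?n)"
  have inj: "inj_on \<alpha> {1..?n}"
    by (rule inj_on_subset[OF Suc.prems(1)]) auto
  have neq: "\<alpha> j \<noteq> b" if "j \<in> {1..?n}" for j
    using inj_onD[OF Suc.prems(1), of j "Suc ?n"] that by (auto simp: b_def)
  let ?f = "\<lambda>y. \<Sum>j=1..?n. C_coeff \<alpha> ?n j * \<alpha> j * y powr (\<alpha> j - b - 1)"
  let ?F = "\<lambda>y. \<Sum>j=1..?n. C_coeff \<alpha> ?n j * \<alpha> j / (\<alpha> j - b) * y powr (\<alpha> j - b)"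
  have integrand: "\<alpha> ?n * y powr (\<alpha> ?n - b - 1) * iter_integral \<alpha> k y = ?f y"
    if "0 < y" "y \<le> 1" for y
  proof -
    have "\<alpha> ?n * y powr (\<alpha> ?n - b - 1) * iter_integral \<alpha> k y
        = y powr (- b) * (\<alpha> ?n * y powr (\<alpha> ?n - 1) * iter_integral \<alpha> k y)"
      by (simp add: powr_add[symmetric] algebra_simps)
    also have "\<dots> = ?f y"
      unfolding Suc.IH[OF inj that] sum_distrib_left
      by (intro sum.cong refl) (simp add: powr_add[symmetric] algebra_simps)
    finally show ?thesis .
  qed
  have "iter_integral \<alpha> ?n x = (LBINT y:{x..1}. ?f y)"
    unfolding iter_integral.simps
    by (rule set_lebesgue_integral_cong) (use Suc.prems integrand in \<open>auto simp: b_def\<close>)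
  also have "\<dots> = ?F 1 - ?F x"
  proof (rule LBINT_FTC)
    fix y assume y: "x \<le> y" "y \<le> 1"
    have "y > 0" using Suc.prems y by simp
    then show "(?F has_real_derivative ?f y) (at y)"
      by (intro DERIV_sum) (auto intro!: derivative_eq_intros simp: neq)
  qed (use Suc.prems in \<open>auto intro!: continuous_intros\<close>)
  also have "\<dots> = (\<Sum>j=1..?n. C_coeff \<alpha> ?n j * \<alpha> j / (b - \<alpha> j) * (x powr (\<alpha> j - b) - 1))"
    unfolding sum_subtractf[symmetric]
  proof (intro sum.cong refl)
    fix j
    have "C_coeff \<alpha> ?n j * \<alpha> j / (\<alpha> j - b) = - (C_coeff \<alpha> ?n j * \<alpha> j / (b - \<alpha> j))"
      by (simp only: minus_diff_eq[of b "\<alpha> j", symmetric] divide_minus_right)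
    then show "C_coeff \<alpha> ?n j * \<alpha> j / (\<alpha> j - b) * 1 powr (\<alpha> j - b)
        - C_coeff \<alpha> ?n j * \<alpha> j / (\<alpha> j - b) * x powr (\<alpha> j - b)
        = C_coeff \<alpha> ?n j * \<alpha> j / (b - \<alpha> j) * (x powr (\<alpha> j - b) - 1)"
      by (simp add: right_diff_distrib)
  qed
  finally have I: "iter_integral \<alpha> ?n x
      = (\<Sum>j=1..?n. C_coeff \<alpha> ?n j * \<alpha> j / (b - \<alpha> j) * (x powr (\<alpha> j - b) - 1))" .
  have "b * x powr (b - 1) * iter_integral \<alpha> ?n x
      = (\<Sum>j=1..?n. C_coeff \<alpha> (Suc ?n) j * \<alpha> j * (x powr (\<alpha> j - 1) - x powr (b - 1)))"
    unfolding I sum_distrib_left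
  proof (intro sum.cong refl)
    fix j assume j: "j \<in> {1..?n}"
    have "x powr (b - 1) * x powr (\<alpha> j - b) = x powr (\<alpha> j - 1)"
      by (simp add: powr_add[symmetric])
    then show "b * x powr (b - 1) * (C_coeff \<alpha> ?n j * \<alpha> j / (b - \<alpha> j) * (x powr (\<alpha> j - b) - 1))
        = C_coeff \<alpha> (Suc ?n) j * \<alpha> j * (x powr (\<alpha> j - 1) - x powr (b - 1))"
      unfolding C_coeff_Suc[OF j] b_def[symmetric] by (simp add: algebra_simps)
  qed
  also have "\<dots> = (\<Sum>j=1..?n. C_coeff \<alpha> (Suc ?n) j * \<alpha> j * x powr (\<alpha> j - 1))
      - x powr (b - 1) * (\<Sum>j=1..?n. C_coeff \<alpha> (Suc ?n) j * \<alpha> j)"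
    by (simp add: algebra_simps sum_subtractf sum_distrib_left)
  also have "(\<Sum>j=1..?n. C_coeff \<alpha> (Suc ?n) j * \<alpha> j) = - C_coeff \<alpha> (Suc ?n) (Suc ?n) * b"
    using sum_C_coeff_mult_eq_0[of ?n \<alpha>] Suc.prems(1) by (simp add: b_def)
  finally show ?case
    by (simp add: b_def algebra_simps)
qed

section \<open>Laws of powers and products\<close>

lemma powr_le_powr_iff:
  fixes x y :: real
  assumes "0 < p" "0 \<le> x" "0 \<le> y"
  shows "x powr p \<le> y powr p \<longleftrightarrow> x \<le> y"
proof
  assume "x powr p \<le> y powr p"
  then show "x \<le> y"
    using powr_less_mono2[of p y x] assms by (cases "x \<le> y") auto
qed (use assms in \<open>auto intro: powr_mono2\<close>)

lemma (in prob_space) distributed_uniform_powr: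
  assumes [measurable]: "U \<in> borel_measurable M"
    and U: "distr M lborel U = uniform_measure lborel {0<..1::real}"
    and a: "0 < a"
  shows "distributed M lborel (\<lambda>\<omega>. U \<omega> powr (1 / a))
    (\<lambda>x. ennreal (indicator {0<..1} x * (a * x powr (a - 1))))"
proof (rule distributedI_borel_atMost[where g = "\<lambda>s. if s \<le> 0 then 0 else min s 1 powr a"])
  let ?g = "\<lambda>s::real. if s \<le> 0 then 0 else min s 1 powr a"
  fix s :: real
  show "(\<integral>\<^sup>+x. ennreal (indicator {0<..1} x * (a * x powr (a - 1)) * indicator {..s} x) \<partial>lborel)
      = ennreal (?g s)"
  proof (cases "s \<le> 0")
    case False
    let ?c = "min s 1"
    have "((\<lambda>x. x powr (a - 1)) has_integral (?c powr (a - 1 + 1) / (a - 1 + 1))) {0..?c}"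
      using False a by (intro has_integral_powr_from_0) auto
    then have "((\<lambda>x. a * x powr (a - 1)) has_integral (a * (?c powr a / a))) {0..?c}"
      by (intro has_integral_mult_right) simp
    then have "((\<lambda>x. a * x powr (a - 1)) has_integral (?c powr a)) {0..?c}"
      using a by simp
    then have "(\<integral>\<^sup>+x. ennreal (a * x powr (a - 1)) * indicator {0..?c} x \<partial>lborel) = ennreal (?c powr a)"
      using a by (intro nn_integral_has_integral_lebesgue') auto
    moreover have "ennreal (indicator {0<..1} x * (a * x powr (a - 1)) * indicator {..s} x)
        = ennreal (a * x powr (a - 1)) * indicator {0..?c} x" for x
      by (auto simp: indicator_def)
    ultimately show ?thesis
      using False by simp
  qed (auto simp: indicator_def intro!: nn_integral_zero')
  let ?A = "{u::real. u powr (1 / a) \<le> s}"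
  have "emeasure M {\<omega> \<in> space M. U \<omega> powr (1 / a) \<le> s} = emeasure (distr M lborel U) ?A"
    by (subst emeasure_distr) (auto intro!: arg_cong[where f = "emeasure M"])
  also have "\<dots> = emeasure lborel ({0<..1} \<inter> ?A)"
    unfolding U by (subst emeasure_uniform_measure) (auto simp: divide_ennreal_def)
  also have "{0<..1} \<inter> ?A = (if s \<le> 0 then {} else {0<..min s 1 powr a})"
  proof (cases "s \<le> 0")
    case True
    have "\<not> u powr (1 / a) \<le> s" if "0 < u" for u
      using le_less_trans[OF True, of "u powr (1 / a)"] that by simp
    then show ?thesis using True by auto
  next
    case False
    have iff: "u \<le> 1 \<and> u powr (1 / a) \<le> s \<longleftrightarrow> u \<le> min s 1 powr a" if "0 < u" for u
    proof -
      have "u \<le> 1 \<longleftrightarrow> u powr (1 / a) \<le> 1"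
        using powr_le_powr_iff[of "1 / a" u 1] a that by simp
      then have "u \<le> 1 \<and> u powr (1 / a) \<le> s \<longleftrightarrow> u powr (1 / a) \<le> min s 1"
        by auto
      also have "\<dots> \<longleftrightarrow> (u powr (1 / a)) powr a \<le> min s 1 powr a"
        using False a by (subst powr_le_powr_iff) auto
      also have "(u powr (1 / a)) powr a = u"
        using a that by (simp add: powr_powr)
      finally show ?thesis .
    qed
    have "{0<..1} \<inter> ?A = {0<..min s 1 powr a}"
      using iff unfolding set_eq_iff Int_iff mem_Collect_eq greaterThanAtMost_iff by blast
    then show ?thesis using False by simp
  qed
  also have "emeasure lborel \<dots> = ennreal (?g s)"
    by simp
  finally show "emeasure M {\<omega> \<in> space M. U \<omega> powr (1 / a) \<le> s} = ennreal (?g s)" .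
qed (use a in auto)

text \<open>Multiplicative convolution: for fixed \<open>y > 0\<close> the substitution \<open>x = z / y\<close> turns
  \<open>\<integral> f x * 1\<^sub>A (x * y) dx\<close> into \<open>\<integral> f (z / y) / y * 1\<^sub>A z dz\<close>, and Tonelli's theorem exchanges the two integrals.
  The variable with density \<open>g\<close> is taken positive so that the Jacobian \<open>1 / y\<close> needs no absolute value.\<close>

lemma (in prob_space) distributed_mult_pos:
  assumes indep: "indep_var borel X borel Y"
    and X: "distributed M lborel X f"
    and Y: "distributed M lborel Y g"
    and g0: "\<And>y::real. y \<le> 0 \<Longrightarrow> g y = 0"
  shows "distributed M lborel (\<lambda>\<omega>. X \<omega> * Y \<omega>)
    (\<lambda>z::real. \<integral>\<^sup>+y. g y * (ennreal (1 / y) * f (z / y)) \<partial>lborel)"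
proof -
  have [measurable]: "f \<in> borel_measurable borel" "g \<in> borel_measurable borel"
    using distributed_borel_measurable[OF X] distributed_borel_measurable[OF Y] by simp_all
  have [measurable]: "X \<in> borel_measurable M" "Y \<in> borel_measurable M"
    using distributed_measurable[OF X] distributed_measurable[OF Y] by simp_all
  have "indep_var lborel (id \<circ> X) lborel (id \<circ> Y)"
    by (rule indep_var_compose[OF indep]) auto
  then have XY: "distributed M (lborel \<Otimes>\<^sub>M lborel) (\<lambda>\<omega>. (X \<omega>, Y \<omega>)) (\<lambda>(x, y). f x * g y)"
    by (intro distributed_joint_indep X Y) (auto simp: lborel.sigma_finite_measure_axioms)
  let ?h = "\<lambda>z. \<integral>\<^sup>+y. g y * (ennreal (1 / y) * f (z / y)) \<partial>lborel"
  have "distr M lborel (\<lambda>\<omega>. X \<omega> * Y \<omega>) = density lborel ?h"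
  proof (rule measure_eqI)
    fix A assume "A \<in> sets (distr M lborel (\<lambda>\<omega>. X \<omega> * Y \<omega>))"
    then have [measurable]: "A \<in> sets borel" by simp
    have inner: "g y * (\<integral>\<^sup>+x. f x * indicator A (x * y) \<partial>lborel)
        = (\<integral>\<^sup>+z. g y * (ennreal (1 / y) * f (z / y)) * indicator A z \<partial>lborel)" for y
    proof (cases "y \<le> 0")
      case False
      then have y: "y > 0" by simp
      have "(\<integral>\<^sup>+x. f x * indicator A (x * y) \<partial>lborel)
          = ennreal (1 / y) * (\<integral>\<^sup>+z. f (z / y) * indicator A z \<partial>lborel)"
        using y by (subst nn_integral_real_affine[where c = "1 / y" and t = 0]) auto
      then show ?thesis
        by (simp add: nn_integral_cmult mult.assoc)
    qed (simp add: g0)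
    have "emeasure (distr M lborel (\<lambda>\<omega>. X \<omega> * Y \<omega>)) A
        = (\<integral>\<^sup>+\<omega>. indicator A (X \<omega> * Y \<omega>) \<partial>M)"
      using nn_integral_distr[of "\<lambda>\<omega>. X \<omega> * Y \<omega>" M lborel "indicator A"] by simp
    also have "\<dots> = (\<integral>\<^sup>+p. (\<lambda>(x, y). f x * g y) p * indicator A (fst p * snd p) \<partial>(lborel \<Otimes>\<^sub>M lborel))"
      by (subst distributed_nn_integral[OF XY]) auto
    also have "\<dots> = (\<integral>\<^sup>+y. \<integral>\<^sup>+x. g y * (f x * indicator A (x * y)) \<partial>lborel \<partial>lborel)"
      by (subst lborel_pair.nn_integral_snd[symmetric]) (auto simp: ac_simps)
    also have "\<dots> = (\<integral>\<^sup>+y. \<integral>\<^sup>+z. g y * (ennreal (1 / y) * f (z / y)) * indicator A z \<partial>lborel \<partial>lborel)"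
      unfolding inner[symmetric] by (simp add: nn_integral_cmult)
    also have "\<dots> = (\<integral>\<^sup>+z. \<integral>\<^sup>+y. g y * (ennreal (1 / y) * f (z / y)) * indicator A z \<partial>lborel \<partial>lborel)"
      by (rule lborel_pair.Fubini') measurable
    also have "\<dots> = emeasure (density lborel ?h) A"
      by (simp add: emeasure_density nn_integral_multc)
    finally show "emeasure (distr M lborel (\<lambda>\<omega>. X \<omega> * Y \<omega>)) A = emeasure (density lborel ?h) A" .
  qed simp
  then show ?thesis
    by (simp add: distributed_def)
qed

section \<open>Density and distribution function of the product\<close>

definition nested_density :: "(nat \<Rightarrow> real) \<Rightarrow> nat \<Rightarrow> real \<Rightarrow> real" where
  "nested_density \<alpha> n x =
     indicator {0<..1} x * (\<alpha> n * x powr (\<alpha> n - 1) * iter_integral \<alpha> (n - 1) x)"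

lemma nested_density_nonneg:
  assumes "1 \<le> n" "\<And>i. i \<in> {1..n} \<Longrightarrow> 0 < \<alpha> i"
  shows "0 \<le> nested_density \<alpha> n x"
proof -
  have "0 \<le> iter_integral \<alpha> (n - 1) x"
    by (rule iter_integral_nonneg) (use assms in auto)
  then show ?thesis
    using assms(2)[of n] assms(1) by (simp add: nested_density_def)
qed

text \<open>The indicators confine \<open>x\<close> to \<open>[z,1]\<close>: the density of the product vanishes above \<open>1\<close>, and that of the
  new factor at \<open>z / x\<close> vanishes when \<open>x < z\<close>. On this interval the powers of \<open>x\<close> combine to the kernel
  \<open>x powr (\<alpha> n - b - 1)\<close> of the next iterated integral.\<close>

lemma nested_density_convolution:
  assumes \<alpha>: "\<And>i. i \<in> {1..Suc n} \<Longrightarrow> 0 < \<alpha> i" and n: "1 \<le> n"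
  defines "b \<equiv> \<alpha> (Suc n)"
  shows "(\<integral>\<^sup>+x. ennreal (nested_density \<alpha> n x) * (ennreal (1 / x) *
      ennreal (indicator {0<..1} (z / x) * (b * (z / x) powr (b - 1)))) \<partial>lborel)
    = ennreal (nested_density \<alpha> (Suc n) z)" (is "(\<integral>\<^sup>+x. ?h x \<partial>lborel) = _")
proof (cases "0 < z \<and> z \<le> 1")
  case False
  have h0: "?h x = 0" for x
    using False by (cases "x > 0") (auto simp: nested_density_def indicator_def field_simps)
  have "(\<integral>\<^sup>+x. ?h x \<partial>lborel) = 0"
    unfolding h0 by simp
  then show ?thesis
    using False by (auto simp: nested_density_def)
next
  case True
  define k where "k = n - 1"
  have k: "n = Suc k" using n by (simp add: k_def)
  define g where "g y = \<alpha> n * y powr (\<alpha> n - b - 1) * iter_integral \<alpha> k y" for y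
  have nonneg: "0 \<le> iter_integral \<alpha> k x" for x
    by (rule iter_integral_nonneg) (use \<alpha> k in auto)
  have pos: "0 < b" "0 < \<alpha> n"
    using \<alpha> n by (auto simp: b_def)
  have cont: "continuous_on {z..1} g"
    unfolding g_def using True
    by (intro continuous_intros continuous_on_subset[OF continuous_on_iter_integral]) auto
  have LB: "(LBINT y:{z..1}. g y) = iter_integral \<alpha> n z"
    by (simp add: k g_def b_def)
  have "?h x = ennreal (b * z powr (b - 1) * g x) * indicator {z..1} x" for x
  proof (cases "z \<le> x \<and> x \<le> 1")
    case zx: True
    then have x: "0 < x" using True by simp
    have "\<alpha> n * x powr (\<alpha> n - 1) * iter_integral \<alpha> k x * (1 / x * (b * (z / x) powr (b - 1)))
        = b * z powr (b - 1) * g x"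
    proof -
      have "x powr (\<alpha> n - b - 1) = x powr (\<alpha> n - 1) / x / x powr (b - 1)"
        using x by (simp add: powr_diff)
      then show ?thesis
        using x True by (simp add: g_def powr_divide)
    qed
    moreover have "nested_density \<alpha> n x = \<alpha> n * x powr (\<alpha> n - 1) * iter_integral \<alpha> k x"
      using x zx by (simp add: nested_density_def k)
    moreover have "indicator {0<..1} (z / x) * (b * (z / x) powr (b - 1)) = b * (z / x) powr (b - 1)"
      using x zx True by simp
    moreover have "0 \<le> \<alpha> n * x powr (\<alpha> n - 1) * iter_integral \<alpha> k x" "0 \<le> 1 / x"
      using x pos nonneg[of x] by simp_all
    ultimately have "?h x = ennreal (b * z powr (b - 1) * g x)"
      by (metis ennreal_mult')
    then show ?thesis
      using zx by simp
  next
    case zx: False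
    then show ?thesis
      using True by (cases "x > 0") (auto simp: nested_density_def indicator_def field_simps)
  qed
  then have "(\<integral>\<^sup>+x. ?h x \<partial>lborel)
      = (\<integral>\<^sup>+x. ennreal (b * z powr (b - 1) * g x) * indicator {z..1} x \<partial>lborel)"
    by (intro nn_integral_cong)
  also have "\<dots> = ennreal (b * z powr (b - 1) * iter_integral \<alpha> n z)"
  proof (rule nn_integral_has_integral_lebesgue')
    have "(g has_integral iter_integral \<alpha> n z) {z..1}"
      using set_borel_integral_eq_integral[OF borel_integrable_atLeastAtMost'[OF cont]] LB
      by (simp add: has_integral_integral)
    then show "((\<lambda>x. b * z powr (b - 1) * g x) has_integral b * z powr (b - 1) * iter_integral \<alpha> n z) {z..1}"
      by (rule has_integral_mult_right)
    show "0 \<le> b * z powr (b - 1) * g x" for x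
      using pos nonneg[of x] by (simp add: g_def)
  qed
  also have "\<dots> = ennreal (nested_density \<alpha> (Suc n) z)"
    using True by (simp add: nested_density_def b_def)
  finally show ?thesis .
qed

lemma (in prob_space) has_pdf_power_prod:
  assumes "1 \<le> n"
    and "indep_vars (\<lambda>_. borel) U {1..n}"
    and "\<And>i. i \<in> {1..n} \<Longrightarrow> distr M lborel (U i) = uniform_measure lborel {0<..1}"
    and "\<And>i. i \<in> {1..n} \<Longrightarrow> 0 < \<alpha> i"
  shows "has_pdf M (power_prod U \<alpha> n) (nested_density \<alpha> n)"
proof -
  have "distributed M lborel (power_prod U \<alpha> n) (\<lambda>x. ennreal (nested_density \<alpha> n x))"
    using assms
  proof (induction n rule: dec_induct)
    case base
    have "U 1 \<in> borel_measurable M"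
      using base.prems(1) by (simp add: indep_vars_def)
    from distributed_uniform_powr[OF this, of "\<alpha> 1"] base.prems show ?case
      by (simp add: power_prod_def nested_density_def[abs_def])
  next
    case (step n)
    let ?V = "\<lambda>i \<omega>. U i \<omega> powr (1 / \<alpha> i)"
    have rv: "U (Suc n) \<in> borel_measurable M"
      using step.prems(1) by (simp add: indep_vars_def)
    have V: "distributed M lborel (?V (Suc n)) (\<lambda>x. ennreal (indicator {0<..1} x *
        (\<alpha> (Suc n) * x powr (\<alpha> (Suc n) - 1))))"
      using step.prems by (intro distributed_uniform_powr rv) auto
    have IH: "distributed M lborel (power_prod U \<alpha> n) (\<lambda>x. ennreal (nested_density \<alpha> n x))"
      by (rule step.IH) (use step.prems in \<open>auto intro: indep_vars_subset\<close>)
    have "indep_vars (\<lambda>_. borel) ?V {1..Suc n}"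
      by (rule indep_vars_compose2[OF step.prems(1), where Y = "\<lambda>i u. u powr (1 / \<alpha> i)"]) simp
    then have "indep_vars (\<lambda>_. borel) ?V (insert (Suc n) {1..n})"
      by (simp add: atLeastAtMostSuc_conv)
    then have indep: "indep_var borel (?V (Suc n)) borel (power_prod U \<alpha> n)"
      unfolding power_prod_def by (rule indep_vars_prod[rotated 2]) auto
    have "(\<integral>\<^sup>+x. ennreal (nested_density \<alpha> n x) * (ennreal (1 / x) *
        ennreal (indicator {0<..1} (z / x) * (\<alpha> (Suc n) * (z / x) powr (\<alpha> (Suc n) - 1)))) \<partial>lborel)
      = ennreal (nested_density \<alpha> (Suc n) z)" for z
      by (rule nested_density_convolution) (use step in auto)
    moreover have "ennreal (nested_density \<alpha> n x) = 0" if "x \<le> 0" for x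
      using that by (simp add: nested_density_def)
    ultimately have "distributed M lborel (\<lambda>\<omega>. ?V (Suc n) \<omega> * power_prod U \<alpha> n \<omega>)
        (\<lambda>z. ennreal (nested_density \<alpha> (Suc n) z))"
      using distributed_mult_pos[OF indep V IH] by simp
    then show ?case
      by (simp add: power_prod_def mult.commute)
  qed
  then show ?thesis
    using nested_density_nonneg[of n \<alpha>] assms by (simp add: has_pdf_def)
qed

text \<open>The density is integrated over the tail \<open>[s,1]\<close> instead of \<open>(0,s]\<close>: it can be unbounded near \<open>0\<close>, while
  on the tail the fundamental theorem of calculus applies directly and gives \<open>G 1 - G s = 1 - G s\<close>.\<close>

lemma (in prob_space) cdf_of_unit_interval_density:
  assumes X: "has_pdf M X (\<lambda>x. indicator {0<..1} x * g x)"
    and G: "\<And>x. 0 < x \<Longrightarrow> x \<le> 1 \<Longrightarrow> (G has_real_derivative g x) (at x)"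
    and G1: "G 1 = 1"
  shows "0 < s \<Longrightarrow> s \<le> 1 \<Longrightarrow> cdf (distr M borel X) s = G s"
    and "1 \<le> s \<Longrightarrow> cdf (distr M borel X) s = 1"
    and "s \<le> 0 \<Longrightarrow> cdf (distr M borel X) s = 0"
proof -
  let ?f = "\<lambda>x. indicator {0<..1} x * g x"
  have D: "distributed M lborel X (\<lambda>x. ennreal (?f x))" and nonneg: "0 \<le> ?f x" for x
    using X by (auto simp: has_pdf_def)
  have [measurable]: "X \<in> borel_measurable M"
    using distributed_measurable[OF D] by simp
  have em: "emeasure M {\<omega> \<in> space M. X \<omega> \<in> A} = (\<integral>\<^sup>+x. ennreal (?f x) * indicator A x \<partial>lborel)"
    if "A \<in> sets borel" for A
    using distributed_emeasure[OF D, of A] that by (simp add: vimage_def Int_def conj_commute)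
  have cdf: "cdf (distr M borel X) s = 1 - prob {\<omega> \<in> space M. X \<omega> \<in> {s<..}}" for s
  proof -
    have "cdf (distr M borel X) s = prob {\<omega> \<in> space M. \<not> X \<omega> \<in> {s<..}}"
      by (simp add: cdf_def measure_distr vimage_def Int_def conj_commute not_less)
    also have "\<dots> = 1 - prob {\<omega> \<in> space M. X \<omega> \<in> {s<..}}"
      by (rule prob_neg) measurable
    finally show ?thesis .
  qed
  have tail: "prob {\<omega> \<in> space M. X \<omega> \<in> {s<..}} = 1 - G s" if s: "0 < s" "s \<le> 1" for s
  proof -
    have "(g has_integral (G 1 - G s)) {s..1}"
      using s G by (intro fundamental_theorem_of_calculus)
        (auto simp: has_real_derivative_iff_has_vector_derivative[symmetric]
          intro: has_field_derivative_at_within)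
    moreover have g: "0 \<le> g x" if "x \<in> {s..1}" for x
      using nonneg[of x] that s by simp
    ultimately have int: "(\<integral>\<^sup>+x. ennreal (g x) * indicator {s..1} x \<partial>lborel) = ennreal (1 - G s)"
      and le: "0 \<le> 1 - G s"
      using nn_integral_has_integral_lebesgue'[of "{s..1}" g "G 1 - G s"] G1
        has_integral_nonneg[of g "G 1 - G s" "{s..1}"] by auto
    have "emeasure M {\<omega> \<in> space M. X \<omega> \<in> {s<..}}
        = (\<integral>\<^sup>+x. ennreal (?f x) * indicator {s<..} x \<partial>lborel)"
      by (rule em) simp
    also have "\<dots> = (\<integral>\<^sup>+x. ennreal (g x) * indicator {s..1} x \<partial>lborel)"
      \<comment> \<open>The two indicators differ at most at the null set \<open>{s}\<close>.\<close>
      using AE_lborel_singleton[of s] s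
      by (intro nn_integral_cong_AE) (auto simp: indicator_def elim!: eventually_mono)
    finally show ?thesis
      using int le by (simp add: measure_def)
  qed
  show "cdf (distr M borel X) s = G s" if "0 < s" "s \<le> 1"
    using cdf tail that by simp
  show "cdf (distr M borel X) s = 1" if "1 \<le> s"
  proof -
    have "ennreal (?f x) * indicator {s<..} x = 0" for x
      using that by (auto simp: indicator_def)
    then have "(\<integral>\<^sup>+x. ennreal (?f x) * indicator {s<..} x \<partial>lborel) = 0"
      by (simp only: nn_integral_const mult_zero_left)
    then show ?thesis
      using em[of "{s<..}"] cdf by (simp add: measure_def)
  qed
  show "cdf (distr M borel X) s = 0" if "s \<le> 0"
  proof -
    have "ennreal (?f x) * indicator {..s} x = 0" for x
      using that by (auto simp: indicator_def)
    then have "(\<integral>\<^sup>+x. ennreal (?f x) * indicator {..s} x \<partial>lborel) = 0"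
      by (simp only: nn_integral_const mult_zero_left)
    then have "prob {\<omega> \<in> space M. X \<omega> \<in> {..s}} = 0"
      using em[of "{..s}"] by (simp add: measure_def)
    then show ?thesis
      by (simp add: cdf_def measure_distr vimage_def Int_def conj_commute)
  qed
qed

text \<open>By the product rule the sum telescopes: the derivative of the logarithmic factor of one summand
  cancels the derivative of the power factor of the preceding one.\<close>

lemma has_derivative_powr_sum_ln:
  assumes "0 < x"
  shows "((\<lambda>s. s powr a * (\<Sum>j=0..k. (- a * ln s) ^ j / fact j)) has_real_derivative
    a * x powr (a - 1) * ((- a * ln x) ^ k / fact k)) (at x)"
proof (induction k)
  case 0
  show ?case
    using assms by (auto intro!: derivative_eq_intros)
next
  case (Suc k)
  let ?L = "\<lambda>j s. (- a * ln s) ^ j / fact j"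
  have "((\<lambda>s. s powr a * (\<Sum>j=0..k. ?L j s) + s powr a * ?L (Suc k) s) has_real_derivative
      a * x powr (a - 1) * ?L k x
      + (a * x powr (a - 1) * ?L (Suc k) x + ?L k x * (- a / x) * x powr a)) (at x)"
    by (intro DERIV_add Suc DERIV_mult has_derivative_power_ln_div_fact has_real_derivative_powr assms)
  moreover have "?L k x * (- a / x) * x powr a = - (a * x powr (a - 1) * ?L k x)"
    using assms by (simp add: powr_diff ac_simps)
  ultimately show ?case
    by (simp add: distrib_left del: power_Suc fact_Suc)
qed

theorem lemma3:
  fixes M :: "'a measure" and U :: "nat \<Rightarrow> 'a \<Rightarrow> real" and \<alpha> :: "nat \<Rightarrow> real" and n :: nat
  assumes "prob_space M"
    and "1 \<le> n"
    and "prob_space.indep_vars M (\<lambda>_. borel) U {1..n}"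
    and "\<And>i. i \<in> {1..n} \<Longrightarrow> distr M lborel (U i) = uniform_measure lborel {0<..1}"
    and "\<And>i. i \<in> {1..n} \<Longrightarrow> 0 < \<alpha> i"
  shows
    "has_pdf M (power_prod U \<alpha> n)
       (\<lambda>x. indicator {0<..1} x * (\<alpha> n * x powr (\<alpha> n - 1) * iter_integral \<alpha> (n - 1) x))
     \<and>
     (\<forall>m a. 1 \<le> m \<and> m \<le> n \<and> (\<forall>i\<in>{1..m}. \<alpha> i = a) \<longrightarrow>
       has_pdf M (power_prod U \<alpha> m)
         (\<lambda>x. indicator {0<..1} x *
            (a * x powr (a - 1) * ((- a * ln x) ^ (m - 1) / fact (m - 1)))) \<and>
       (\<forall>s. 0 < s \<and> s \<le> 1 \<longrightarrow>
          cdf (distr M borel (power_prod U \<alpha> m)) s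
            = s powr a * (\<Sum>j=0..m-1. (- a * ln s) ^ j / fact j)) \<and>
       (\<forall>s\<ge>1. cdf (distr M borel (power_prod U \<alpha> m)) s = 1) \<and>
       (\<forall>s<0. cdf (distr M borel (power_prod U \<alpha> m)) s = 0))
     \<and>
     (inj_on \<alpha> {1..n} \<longrightarrow>
       has_pdf M (power_prod U \<alpha> n)
         (\<lambda>x. indicator {0<..1} x * (\<Sum>j=1..n. C_coeff \<alpha> n j * \<alpha> j * x powr (\<alpha> j - 1))) \<and>
       (\<forall>x. 0 < x \<and> x \<le> 1 \<longrightarrow>
          (\<Sum>j=1..n. C_coeff \<alpha> n j * \<alpha> j * x powr (\<alpha> j - 1))
            = (\<Prod>k=1..n. \<alpha> k) * (\<Sum>j=1..n. c_coeff \<alpha> n j * x powr (\<alpha> j - 1))) \<and>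
       (\<forall>s. 0 < s \<and> s \<le> 1 \<longrightarrow>
          cdf (distr M borel (power_prod U \<alpha> n)) s = (\<Sum>j=1..n. C_coeff \<alpha> n j * s powr \<alpha> j)) \<and>
       (\<Sum>j=1..n. C_coeff \<alpha> n j) = 1)"
proof -
  interpret prob_space M by fact
  have pdf: "has_pdf M (power_prod U \<alpha> m) (nested_density \<alpha> m)" if "1 \<le> m" "m \<le> n" for m
    by (rule has_pdf_power_prod)
      (use assms that in \<open>auto intro: indep_vars_subset\<close>)
  have a: "has_pdf M (power_prod U \<alpha> n)
       (\<lambda>x. indicator {0<..1} x * (\<alpha> n * x powr (\<alpha> n - 1) * iter_integral \<alpha> (n - 1) x))"
    using pdf[of n] assms(2) by (simp add: nested_density_def[abs_def])
  have b: "has_pdf M (power_prod U \<alpha> m)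
         (\<lambda>x. indicator {0<..1} x *
            (a * x powr (a - 1) * ((- a * ln x) ^ (m - 1) / fact (m - 1)))) \<and>
       (\<forall>s. 0 < s \<and> s \<le> 1 \<longrightarrow>
          cdf (distr M borel (power_prod U \<alpha> m)) s
            = s powr a * (\<Sum>j=0..m-1. (- a * ln s) ^ j / fact j)) \<and>
       (\<forall>s\<ge>1. cdf (distr M borel (power_prod U \<alpha> m)) s = 1) \<and>
       (\<forall>s<0. cdf (distr M borel (power_prod U \<alpha> m)) s = 0)"
    if m: "1 \<le> m" "m \<le> n" "\<forall>i\<in>{1..m}. \<alpha> i = a" for m a
  proof -
    let ?g = "\<lambda>x. a * x powr (a - 1) * ((- a * ln x) ^ (m - 1) / fact (m - 1))"
    let ?G = "\<lambda>s. s powr a * (\<Sum>j=0..m-1. (- a * ln s) ^ j / fact j)"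
    have "nested_density \<alpha> m = (\<lambda>x. indicator {0<..1} x * ?g x)"
      using iter_integral_const[of "m - 1" \<alpha> a] m
      by (intro ext) (auto simp: nested_density_def indicator_def)
    then have X: "has_pdf M (power_prod U \<alpha> m) (\<lambda>x. indicator {0<..1} x * ?g x)"
      using pdf[of m] m by simp
    have G1: "?G 1 = 1"
      by (simp add: sum.atLeast_Suc_atMost power_0_left)
    note F = cdf_of_unit_interval_density[OF X has_derivative_powr_sum_ln G1]
    show ?thesis
      using X F by simp
  qed
  have c: "has_pdf M (power_prod U \<alpha> n)
         (\<lambda>x. indicator {0<..1} x * (\<Sum>j=1..n. C_coeff \<alpha> n j * \<alpha> j * x powr (\<alpha> j - 1))) \<and>
       (\<forall>x. 0 < x \<and> x \<le> 1 \<longrightarrow>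
          (\<Sum>j=1..n. C_coeff \<alpha> n j * \<alpha> j * x powr (\<alpha> j - 1))
            = (\<Prod>k=1..n. \<alpha> k) * (\<Sum>j=1..n. c_coeff \<alpha> n j * x powr (\<alpha> j - 1))) \<and>
       (\<forall>s. 0 < s \<and> s \<le> 1 \<longrightarrow>
          cdf (distr M borel (power_prod U \<alpha> n)) s = (\<Sum>j=1..n. C_coeff \<alpha> n j * s powr \<alpha> j)) \<and>
       (\<Sum>j=1..n. C_coeff \<alpha> n j) = 1"
    if inj: "inj_on \<alpha> {1..n}"
  proof -
    let ?g = "\<lambda>x. \<Sum>j=1..n. C_coeff \<alpha> n j * \<alpha> j * x powr (\<alpha> j - 1)"
    let ?G = "\<lambda>s. \<Sum>j=1..n. C_coeff \<alpha> n j * s powr \<alpha> j"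
    have sum1: "(\<Sum>j=1..n. C_coeff \<alpha> n j) = 1"
      by (rule sum_C_coeff[OF assms(2) inj])
    have "nested_density \<alpha> n = (\<lambda>x. indicator {0<..1} x * ?g x)"
      using iter_integral_distinct[of \<alpha> "n - 1"] assms(2) inj
      by (intro ext) (auto simp: nested_density_def indicator_def)
    then have X: "has_pdf M (power_prod U \<alpha> n) (\<lambda>x. indicator {0<..1} x * ?g x)"
      using pdf[of n] assms(2) by simp
    have G: "(?G has_real_derivative ?g x) (at x)" if "0 < x" for x
      using that by (intro DERIV_sum) (auto intro!: derivative_eq_intros)
    have G1: "?G 1 = 1"
      using sum1 by simp
    have "?g x = (\<Prod>k=1..n. \<alpha> k) * (\<Sum>j=1..n. c_coeff \<alpha> n j * x powr (\<alpha> j - 1))" for x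
      unfolding sum_distrib_left mult.assoc[symmetric]
      by (intro sum.cong refl) (simp only: C_coeff_eq_prod_c_coeff)
    then show ?thesis
      using X sum1 cdf_of_unit_interval_density(1)[OF X G G1] by blast
  qed
  show ?thesis
    using a b c by blast
qed

end
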